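(* For every integer $k\ge2$, there exist $2$-circuit bounded systems that are not $k$-growth systems.
   Context: An independence system $(S,\mathcal{I})$ is a finite set $S$ with a nonempty downward-closed family $\mathcal{I}\subseteq2^S$ of independent sets. Circuits are the inclusion-wise minimal non-independent sets. A basis of $X\subseteq S$ is an inclusion-wise maximal independent subset of $X$. $k$-growth: for all $X\subseteq S$ and all $I\in\mathcal{I}$ there is a partition $(Q,Z)$ of $I\setminus X$ with $|Z|\le k|X\setminus I|$ such that $P\cup Q\in\mathcal{I}$ for every basis $P$ of $X$. $k$-circuit bounded: for every $I\in\mathcal{I}$ and every $e\in S\setminus I$, the set $I\cup\{e\}$ contains at most $k$ distinct circuits. *)

theory Defs imports Main
begin

definition independence_system :: "'a set \<Rightarrow> 'a set set \<Rightarrow> bool" where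
  "independence_system S \<I> \<longleftrightarrow>
     finite S \<and> \<I> \<subseteq> Pow S \<and> \<I> \<noteq> {} \<and> (\<forall>I\<in>\<I>. \<forall>J. J \<subseteq> I \<longrightarrow> J \<in> \<I>)"

definition circuit :: "'a set \<Rightarrow> 'a set set \<Rightarrow> 'a set \<Rightarrow> bool" where
  "circuit S \<I> C \<longleftrightarrow>
     C \<subseteq> S \<and> C \<notin> \<I> \<and> (\<forall>D. D \<subseteq> S \<and> D \<notin> \<I> \<and> D \<subseteq> C \<longrightarrow> D = C)"

definition basis_of :: "'a set set \<Rightarrow> 'a set \<Rightarrow> 'a set \<Rightarrow> bool" where
  "basis_of \<I> X P \<longleftrightarrow>
     P \<in> \<I> \<and> P \<subseteq> X \<and> (\<forall>P'. P' \<in> \<I> \<and> P' \<subseteq> X \<and> P \<subseteq> P' \<longrightarrow> P' = P)"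

text \<open>The partition \<open>(Q, Z)\<close> is an ordered pair of disjoint, possibly empty parts, and it is
  chosen before the basis \<open>P\<close>: a single \<open>Q\<close> has to serve all bases of \<open>X\<close>.\<close>

definition growth_system :: "nat \<Rightarrow> 'a set \<Rightarrow> 'a set set \<Rightarrow> bool" where
  "growth_system k S \<I> \<longleftrightarrow> independence_system S \<I> \<and>
     (\<forall>X I. X \<subseteq> S \<and> I \<in> \<I> \<longrightarrow>
        (\<exists>Q Z. Q \<union> Z = I - X \<and> Q \<inter> Z = {} \<and> card Z \<le> k * card (X - I) \<and>
               (\<forall>P. basis_of \<I> X P \<longrightarrow> P \<union> Q \<in> \<I>)))"

definition circuit_bounded_system :: "nat \<Rightarrow> 'a set \<Rightarrow> 'a set set \<Rightarrow> bool" where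
  "circuit_bounded_system k S \<I> \<longleftrightarrow> independence_system S \<I> \<and>
     (\<forall>I\<in>\<I>. \<forall>e\<in>S - I. card {C. circuit S \<I> C \<and> C \<subseteq> I \<union> {e}} \<le> k)"

end

theory Submission imports Defs
begin

text \<open>Let \<open>X\<close> consist of \<open>n\<close> disjoint pairs, and give each of the \<open>2 ^ n\<close> transversals \<open>T\<close> a
  private new element \<open>z\<^sub>T\<close>. The circuits are the pairs and the sets \<open>T \<union> {z\<^sub>T}\<close>. An independent
  set contains no pair, so adding one element of a pair completes at most that pair and one
  transversal. Every transversal is a basis of \<open>X\<close>, so for \<open>I = {z\<^sub>T | T}\<close> the set \<open>Q\<close> must be
  empty, and growth would force \<open>2 ^ n \<le> k \<cdot> 2n\<close>.\<close>

definition avoiding :: "'a set \<Rightarrow> 'a set set \<Rightarrow> 'a set set" where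
  "avoiding S \<C> = {J. J \<subseteq> S \<and> (\<forall>C\<in>\<C>. \<not> C \<subseteq> J)}"

lemma independence_system_avoiding:
  assumes "finite S" "{} \<notin> \<C>"
  shows "independence_system S (avoiding S \<C>)"
proof -
  have "{} \<in> avoiding S \<C>" using assms by (auto simp: avoiding_def)
  moreover have "\<forall>I\<in>avoiding S \<C>. \<forall>J. J \<subseteq> I \<longrightarrow> J \<in> avoiding S \<C>"
    "avoiding S \<C> \<subseteq> Pow S"
    unfolding avoiding_def by blast+
  ultimately show ?thesis
    using assms(1) unfolding independence_system_def by blast
qed

text \<open>A dependent set contains a member of \<open>\<C>\<close>, which is itself dependent, so
  minimality forces equality. This inclusion suffices for upper bounds on the number of circuits:
  members of \<open>\<C>\<close> can be counted instead.\<close>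

lemma circuit_avoiding:
  assumes "circuit S (avoiding S \<C>) C"
  shows "C \<in> \<C>"
proof -
  from assms obtain D where D: "D \<in> \<C>" "D \<subseteq> C"
    by (auto simp: circuit_def avoiding_def)
  then have "D \<subseteq> S" "D \<notin> avoiding S \<C>"
    using assms by (auto simp: circuit_def avoiding_def)
  then have "D = C" using assms D unfolding circuit_def by blast
  with D show ?thesis by simp
qed

lemma circuit_bounded_avoiding:
  assumes "finite S" "{} \<notin> \<C>"
    and "\<And>J e. J \<in> avoiding S \<C> \<Longrightarrow> e \<in> S - J \<Longrightarrow>
      \<exists>\<D>. finite \<D> \<and> card \<D> \<le> k \<and> {C\<in>\<C>. C \<subseteq> insert e J} \<subseteq> \<D>"
  shows "circuit_bounded_system k S (avoiding S \<C>)"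
  unfolding circuit_bounded_system_def
proof (intro conjI ballI)
  show "independence_system S (avoiding S \<C>)"
    by (rule independence_system_avoiding[OF assms(1,2)])
  fix J e assume "J \<in> avoiding S \<C>" "e \<in> S - J"
  from assms(3)[OF this] obtain \<D> where
    \<D>: "finite \<D>" "card \<D> \<le> k" "{C\<in>\<C>. C \<subseteq> insert e J} \<subseteq> \<D>" by blast
  have "{C. circuit S (avoiding S \<C>) C \<and> C \<subseteq> J \<union> {e}} \<subseteq> \<D>"
    using \<D>(3) circuit_avoiding by fastforce
  from card_mono[OF \<D>(1) this] \<D>(2)
  show "card {C. circuit S (avoiding S \<C>) C \<and> C \<subseteq> J \<union> {e}} \<le> k" by simp
qed

text \<open>The pairs are \<open>{i, n + i}\<close> for \<open>i < n\<close>. The index set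
  \<open>A\<close> records where the lower element is chosen, so the subsets of
  \<open>{..<n}\<close> encode the \<open>2 ^ n\<close> transversals.\<close>

definition transversal :: "nat \<Rightarrow> nat set \<Rightarrow> nat set" where
  "transversal n A = A \<union> (+) n ` ({..<n} - A)"

definition pairs :: "nat \<Rightarrow> nat set set" where
  "pairs n = (\<lambda>i. {i, n + i}) ` {..<n}"

definition marked_transversals :: "nat \<Rightarrow> (nat set \<Rightarrow> nat) \<Rightarrow> nat set set" where
  "marked_transversals n z = (\<lambda>A. insert (z A) (transversal n A)) ` Pow {..<n}"

lemma transversal_subset: "A \<subseteq> {..<n} \<Longrightarrow> transversal n A \<subseteq> {..<2*n}"
  by (auto simp: transversal_def)

lemma add_mem_transversal_iff:
  "A \<subseteq> {..<n} \<Longrightarrow> i < n \<Longrightarrow> n + i \<in> transversal n A \<longleftrightarrow> i \<notin> A"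
  by (auto simp: transversal_def)

lemma mem_transversal_iff: "i < n \<Longrightarrow> i \<in> transversal n A \<longleftrightarrow> i \<in> A"
  by (auto simp: transversal_def)

context
  fixes n :: nat and z :: "nat set \<Rightarrow> nat" and S :: "nat set" and \<C> :: "nat set set"
  assumes n: "n > 0"
    and inj_z: "inj_on z (Pow {..<n})"
    and z_ge: "\<And>A. 2 * n \<le> z A"
  defines "S \<equiv> {..<2*n} \<union> z ` Pow {..<n}"
    and "\<C> \<equiv> pairs n \<union> marked_transversals n z"
begin

lemma z_notin_transversal: "B \<subseteq> {..<n} \<Longrightarrow> z A \<notin> transversal n B"
  using transversal_subset[of B n] z_ge[of A] by force

lemma avoiding_pair:
  assumes "J \<in> avoiding S \<C>" "i < n" "i \<in> J"
  shows "n + i \<notin> J"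
proof -
  have "{i, n + i} \<in> \<C>" using assms(2) unfolding \<C>_def pairs_def by blast
  then have "\<not> {i, n + i} \<subseteq> J" using assms(1) unfolding avoiding_def by blast
  with assms(3) show ?thesis by simp
qed

text \<open>Away from the pair of \<open>e\<close> the transversal must lie in \<open>J\<close>, and
  \<open>J\<close> holds at most one element of each pair. Hence \<open>J\<close> dictates the
  choice there.\<close>

lemma completed_transversal_determined:
  assumes J: "J \<in> avoiding S \<C>" and A: "A \<subseteq> {..<n}"
    and sub: "transversal n A \<subseteq> insert e J"
    and i: "i < n" "i \<noteq> e" "n + i \<noteq> e"
  shows "i \<in> A \<longleftrightarrow> i \<in> J"
proof
  assume "i \<in> A"
  then show "i \<in> J" using sub i mem_transversal_iff[of i n A] by auto
next
  assume "i \<in> J"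
  then have "n + i \<notin> J" by (rule avoiding_pair[OF J i(1)])
  then show "i \<in> A" using sub i add_mem_transversal_iff[OF A, of i] by auto
qed

lemma circuit_bounded_marked_transversals:
  "circuit_bounded_system 2 S (avoiding S \<C>)"
proof (rule circuit_bounded_avoiding)
  show "finite S" by (simp add: S_def)
  show "{} \<notin> \<C>" by (auto simp: \<C>_def pairs_def marked_transversals_def)
  fix J e assume J: "J \<in> avoiding S \<C>" and e: "e \<in> S - J"
  let ?M = "\<lambda>A. insert (z A) (transversal n A)"
  \<comment> \<open>\<open>J\<close> contains no member of \<open>\<C>\<close>, so whatever
    \<open>e\<close> completes must use \<open>e\<close>.\<close>
  have e_mem: "e \<in> C" if "C \<in> \<C>" "C \<subseteq> insert e J" for C
    using J that unfolding avoiding_def by blast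
  consider A where "A \<subseteq> {..<n}" "e = z A" | j where "j < n" "e = j \<or> e = n + j"
  proof (cases "e < 2 * n")
    case True
    then have "e < n \<or> (e - n < n \<and> e = n + (e - n))" by linarith
    with that(2) show ?thesis by blast
  next
    case False
    with e that(1) show ?thesis by (auto simp: S_def)
  qed
  then show "\<exists>\<D>. finite \<D> \<and> card \<D> \<le> 2 \<and> {C\<in>\<C>. C \<subseteq> insert e J} \<subseteq> \<D>"
  proof cases
    case 1
    have "C = ?M A" if C: "C \<in> \<C>" "C \<subseteq> insert e J" for C
    proof -
      have "C \<notin> pairs n"
        using e_mem[OF C] z_ge[of A] 1 by (auto simp: pairs_def)
      then obtain B where B: "B \<subseteq> {..<n}" "C = ?M B"
        using C(1) by (auto simp: \<C>_def marked_transversals_def)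
      then have "z A = z B" using e_mem[OF C] z_notin_transversal 1 by auto
      then show ?thesis using inj_onD[OF inj_z] B 1 by auto
    qed
    then have "{C\<in>\<C>. C \<subseteq> insert e J} \<subseteq> {?M A}" by blast
    then show ?thesis by (intro exI[of _ "{?M A}"]) auto
  next
    case 2
    let ?B = "J \<inter> {..<n}"
    \<comment> \<open>The only possible index set: \<open>J\<close> decides every pair except pair
      \<open>j\<close>, where the transversal must choose \<open>e\<close> itself. If
      \<open>e = n + j\<close>, then \<open>j\<close> may lie in \<open>J\<close> and has to be
      removed.\<close>
    let ?A = "if e = j then insert j ?B else ?B - {j}"
    have "C = {j, n + j} \<or> C = ?M ?A" if C: "C \<in> \<C>" "C \<subseteq> insert e J" for C
    proof (cases "C \<in> pairs n")
      case True
      then show ?thesis using e_mem[OF C] 2 by (auto simp: pairs_def)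
    next
      case False
      then obtain A where A: "A \<subseteq> {..<n}" "C = ?M A"
        using C(1) by (auto simp: \<C>_def marked_transversals_def)
      have eq: "i \<in> A \<longleftrightarrow> i \<in> J" if "i < n" "i \<noteq> j" for i
        using completed_transversal_determined[OF J A(1), of e i] A C(2) that 2 by auto
      have "e \<noteq> z A" using z_ge[of A] 2 by auto
      then have "e \<in> transversal n A" using e_mem[OF C] A by auto
      then have j: "j \<in> A \<longleftrightarrow> e = j"
        using 2 mem_transversal_iff[of j n A] add_mem_transversal_iff[OF A(1), of j] n by auto
      have "A = ?A"
        using eq j A(1) 2 by (intro set_eqI) (auto split: if_splits)
      from A(2) arg_cong[OF this, of ?M] have "C = ?M ?A" by (rule trans)
      then show ?thesis ..
    qed
    then have "{C\<in>\<C>. C \<subseteq> insert e J} \<subseteq> {{j, n + j}, ?M ?A}" by blast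
    moreover have "card {{j, n + j}, ?M ?A} \<le> 2" by (simp add: card_insert_if)
    ultimately show ?thesis by (intro exI[of _ "{{j, n + j}, ?M ?A}"]) auto
  qed
qed

text \<open>A transversal contains neither a full pair nor a mark, hence is independent; any further
  element below \<open>2 * n\<close> would complete a pair.\<close>

lemma basis_transversal:
  assumes A: "A \<subseteq> {..<n}"
  shows "basis_of (avoiding S \<C>) {..<2*n} (transversal n A)"
  unfolding basis_of_def
proof (intro conjI allI impI)
  have "\<not> C \<subseteq> transversal n A" if "C \<in> \<C>" for C
    using that z_notin_transversal[OF A] mem_transversal_iff[of _ n A]
      add_mem_transversal_iff[OF A]
    by (auto simp: \<C>_def pairs_def marked_transversals_def)
  then show "transversal n A \<in> avoiding S \<C>"
    using transversal_subset[OF A] by (auto simp: avoiding_def S_def)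
  show "transversal n A \<subseteq> {..<2*n}" by (rule transversal_subset[OF A])
  fix P assume P: "P \<in> avoiding S \<C> \<and> P \<subseteq> {..<2*n} \<and> transversal n A \<subseteq> P"
  have pair: "\<not> (i \<in> P \<and> n + i \<in> P)" if "i < n" for i
    using P avoiding_pair that by blast
  have "y \<in> transversal n A" if y: "y \<in> P" for y
  proof (cases "y < n")
    case True
    then show ?thesis
      using pair[OF True] y P add_mem_transversal_iff[OF A True] mem_transversal_iff[OF True, of A]
      by auto
  next
    case False
    define j where "j = y - n"
    have "y < 2 * n" using y P by auto
    with False have j: "j < n" "y = n + j" by (auto simp: j_def)
    then show ?thesis
      using pair[OF j(1)] y P add_mem_transversal_iff[OF A j(1)] mem_transversal_iff[OF j(1), of A]
      by auto
  qed
  with P show "P = transversal n A" by blast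
qed

text \<open>Every forbidden set has an element below \<open>2 * n\<close>, while all marks lie
  beyond. For a marked transversal, the choice from pair \<open>0\<close> provides such an element,
  as \<open>n > 0\<close>.\<close>

lemma marks_independent: "z ` Pow {..<n} \<in> avoiding S \<C>"
proof -
  have notin: "i \<notin> z ` Pow {..<n}" if "i < 2 * n" for i
    using z_ge that by (metis imageE linorder_not_le)
  have "\<exists>i\<in>C. i < 2 * n" if C: "C \<in> \<C>" for C
  proof (cases "C \<in> pairs n")
    case True
    then show ?thesis by (force simp: pairs_def)
  next
    case False
    then obtain A where "A \<subseteq> {..<n}" "C = insert (z A) (transversal n A)"
      using C by (auto simp: \<C>_def marked_transversals_def)
    moreover have "0 \<in> transversal n A \<or> n \<in> transversal n A"
      using n by (force simp: transversal_def)
    ultimately show ?thesis using n by force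
  qed
  with notin have "\<not> C \<subseteq> z ` Pow {..<n}" if "C \<in> \<C>" for C
    using that by blast
  then show ?thesis by (auto simp: avoiding_def S_def)
qed

lemma growth_marked_transversals_imp_le:
  assumes "growth_system k S (avoiding S \<C>)"
  shows "2 ^ n \<le> k * (2 * n)"
proof -
  let ?I = "z ` Pow {..<n}"
  have disj: "?I - {..<2*n} = ?I" "{..<2*n} - ?I = {..<2*n}"
    using z_ge by (auto simp flip: not_le)
  have "{..<2*n} \<subseteq> S" by (auto simp: S_def)
  with assms marks_independent obtain Q Z where
    QZ: "Q \<union> Z = ?I" "card Z \<le> k * (2 * n)"
    and ext: "\<And>P. basis_of (avoiding S \<C>) {..<2*n} P \<Longrightarrow> P \<union> Q \<in> avoiding S \<C>"
    unfolding growth_system_def by (metis disj card_lessThan)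
  \<comment> \<open>If \<open>Q\<close> contained \<open>z A\<close>, extending the basis
    \<open>transversal n A\<close> by \<open>Q\<close> would produce the forbidden set marked by
    \<open>z A\<close>. As one \<open>Q\<close> serves all bases, every mark is excluded.\<close>
  have "z A \<notin> Q" if A: "A \<subseteq> {..<n}" for A
    using ext[OF basis_transversal[OF A]] A
    by (auto simp: avoiding_def \<C>_def marked_transversals_def)
  with QZ(1) have "Z = ?I" by auto
  with QZ(2) show ?thesis by (simp add: card_image[OF inj_z] card_Pow)
qed

end

theorem theorem13:
  fixes k :: nat
  assumes "k \<ge> 2"
  shows "\<exists>(S :: nat set) \<I>. circuit_bounded_system 2 S \<I> \<and> \<not> growth_system k S \<I>"
proof -
  \<comment> \<open>With this \<open>n\<close> the growth bound \<open>k * (2 * n)\<close> is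
    \<open>8 * k * k\<close>, and \<open>2 ^ n\<close> splits as
    \<open>2 ^ (2 * k) * (2 ^ k * 2 ^ k)\<close>. The first factor is at least \<open>16\<close>
    because \<open>k \<ge> 2\<close>, and the others exceed \<open>k\<close> each.\<close>
  define n where "n = 4 * k"
  have n: "n > 0" using assms by (simp add: n_def)
  \<comment> \<open>Any injective numbering of the index sets gives marks; the shift by
    \<open>2 * n\<close> keeps them clear of the pairs.\<close>
  obtain f :: "nat set \<Rightarrow> nat" where f: "inj_on f (Pow {..<n})"
    using finite_imp_inj_to_nat_seg[of "Pow {..<n}"] by auto
  define z where "z A = 2 * n + f A" for A
  have z: "inj_on z (Pow {..<n})" "\<And>A. 2 * n \<le> z A"
    using f by (auto simp: z_def inj_on_def)
  have "k * k < 2 ^ k * 2 ^ k" by (intro mult_strict_mono) auto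
  moreover have "(2::nat) ^ 4 \<le> 2 ^ (2 * k)" 
    using assms by (intro power_increasing) auto
  ultimately have "16 * (k * k) < 2 ^ (2 * k) * (2 ^ k * 2 ^ k)"
    using assms by (intro mult_le_less_imp_less) auto
  also have "\<dots> = 2 ^ n" by (simp add: n_def flip: power_add)
  finally have "\<not> 2 ^ n \<le> k * (2 * n)" by (simp add: n_def)
  with circuit_bounded_marked_transversals[OF n z] growth_marked_transversals_imp_le[OF n z]
  show ?thesis by blast
qed

end
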